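(* Let $L$ be a bounded lattice. Then $L$ is a $d$-lattice if and only if every maximal ideal of $L$ is prime and every maximal filter of $L$ is prime.
   Context: For elements $x,y$ of a lattice $L$, $\theta(x,y)$ denotes the least (lattice) congruence on $L$ containing the pair $(x,y)$. A $d$-lattice is a bounded lattice $(L,\vee,\wedge,0,1)$ such that for all $a,c\in L$: (i) if $(a,1)\in\theta(0,c)$ then $a\vee c=1$; and (ii) if $(a,0)\in\theta(1,c)$ then $a\wedge c=0$. Ideals and filters are nonempty. A maximal ideal (filter) is a proper ideal (filter) that is maximal under inclusion among proper ideals (filters). A proper ideal $I$ is prime if $x\wedge y\in I$ implies $x\in I$ or $y\in I$; a proper filter $F$ is prime if $x\vee y\in F$ implies $x\in F$ or $y\in F$. *)

theory Defs
  imports Main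
begin

text \<open>A lattice is the universe of a type of class \<open>lattice\<close> (bounded: \<open>bounded_lattice\<close>, with
  0 and 1 written \<open>bot\<close> and \<open>top\<close>). The class does not require \<open>bot \<noteq> top\<close>, so the one-element
  lattice is included.\<close>

definition lattice_congruence :: "('a::lattice \<times> 'a) set \<Rightarrow> bool" where
  "lattice_congruence r \<longleftrightarrow> equiv UNIV r \<and>
     (\<forall>a b c d. (a, b) \<in> r \<longrightarrow> (c, d) \<in> r \<longrightarrow> (sup a c, sup b d) \<in> r \<and> (inf a c, inf b d) \<in> r)"

definition theta :: "'a::lattice \<Rightarrow> 'a \<Rightarrow> ('a \<times> 'a) set" where
  "theta x y = \<Inter> {r. lattice_congruence r \<and> (x, y) \<in> r}"

lemma lattice_congruence_theta: "lattice_congruence (theta x y)"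
proof -
  have "equiv UNIV (theta x y)"
  proof (rule equivI)
    show "theta x y \<subseteq> UNIV \<times> UNIV" by simp
    show "refl_on UNIV (theta x y)"
      by (simp add: theta_def lattice_congruence_def equiv_def refl_on_def)
    show "sym (theta x y)"
      by (rule symI) (auto simp: theta_def lattice_congruence_def equiv_def dest: symD)
    show "trans (theta x y)"
    proof (rule transI)
      fix a b c assume ab: "(a, b) \<in> theta x y" and bc: "(b, c) \<in> theta x y"
      show "(a, c) \<in> theta x y"
        unfolding theta_def
      proof (rule InterI)
        fix r assume r: "r \<in> {r. lattice_congruence r \<and> (x, y) \<in> r}"
        then have "(a, b) \<in> r" "(b, c) \<in> r"
          using ab bc unfolding theta_def by (meson InterD)+
        moreover have "trans r"
          using r by (simp add: lattice_congruence_def equiv_def)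
        ultimately show "(a, c) \<in> r" by (meson transD)
      qed
    qed
  qed
  then show ?thesis
    by (simp add: lattice_congruence_def theta_def)
qed

lemma theta_contains: "(x, y) \<in> theta x y"
  by (auto simp: theta_def)

lemma theta_least: "lattice_congruence r \<Longrightarrow> (x, y) \<in> r \<Longrightarrow> theta x y \<subseteq> r"
  by (auto simp: theta_def)

definition d_lattice :: "'a::bounded_lattice itself \<Rightarrow> bool" where
  "d_lattice TYPE('a) \<longleftrightarrow>
     (\<forall>a c :: 'a. ((a, top) \<in> theta bot c \<longrightarrow> sup a c = top) \<and>
                  ((a, bot) \<in> theta top c \<longrightarrow> inf a c = bot))"

definition lattice_ideal :: "'a::lattice set \<Rightarrow> bool" where
  "lattice_ideal I \<longleftrightarrow> I \<noteq> {} \<and> (\<forall>x\<in>I. \<forall>y. y \<le> x \<longrightarrow> y \<in> I) \<and> (\<forall>x\<in>I. \<forall>y\<in>I. sup x y \<in> I)"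

definition lattice_filter :: "'a::lattice set \<Rightarrow> bool" where
  "lattice_filter F \<longleftrightarrow> F \<noteq> {} \<and> (\<forall>x\<in>F. \<forall>y. x \<le> y \<longrightarrow> y \<in> F) \<and> (\<forall>x\<in>F. \<forall>y\<in>F. inf x y \<in> F)"

definition proper_ideal :: "'a::lattice set \<Rightarrow> bool" where
  "proper_ideal I \<longleftrightarrow> lattice_ideal I \<and> I \<noteq> UNIV"

definition proper_filter :: "'a::lattice set \<Rightarrow> bool" where
  "proper_filter F \<longleftrightarrow> lattice_filter F \<and> F \<noteq> UNIV"

definition maximal_ideal :: "'a::lattice set \<Rightarrow> bool" where
  "maximal_ideal I \<longleftrightarrow> proper_ideal I \<and> (\<forall>J. proper_ideal J \<and> I \<subseteq> J \<longrightarrow> J = I)"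

definition maximal_filter :: "'a::lattice set \<Rightarrow> bool" where
  "maximal_filter F \<longleftrightarrow> proper_filter F \<and> (\<forall>G. proper_filter G \<and> F \<subseteq> G \<longrightarrow> G = F)"

definition prime_ideal :: "'a::lattice set \<Rightarrow> bool" where
  "prime_ideal I \<longleftrightarrow> proper_ideal I \<and> (\<forall>x y. inf x y \<in> I \<longrightarrow> x \<in> I \<or> y \<in> I)"

definition prime_filter :: "'a::lattice set \<Rightarrow> bool" where
  "prime_filter F \<longleftrightarrow> proper_filter F \<and> (\<forall>x y. sup x y \<in> F \<longrightarrow> x \<in> F \<or> y \<in> F)"

end

theory Submission
  imports Defs
begin

text \<open>A prime ideal or filter and its complement are the two classes of a congruence.
  If \<open>(a, top) \<in> theta bot c\<close> but \<open>sup a c \<noteq> top\<close>, Zorn's lemma extends the principal ideal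
  of \<open>sup a c\<close> to a maximal ideal; were it prime, its congruence would identify \<open>bot\<close> with \<open>c\<close>
  but not \<open>a\<close> with \<open>top\<close>. Conversely, if a maximal ideal \<open>I\<close> contains \<open>inf x y\<close> but neither
  \<open>x\<close> nor \<open>y\<close>, maximality yields \<open>m \<in> I\<close> above \<open>inf x y\<close> with \<open>sup x m = top = sup y m\<close>. Then
  \<open>theta bot m\<close> identifies \<open>x\<close> and \<open>y\<close>, hence \<open>inf x y\<close>, with \<open>top\<close>, so the first axiom of a
  d-lattice gives \<open>m = sup (inf x y) m = top\<close>. Filters are treated dually.\<close>

section \<open>Membership laws for ideals and filters\<close>

lemma lattice_ideal_sup_iff:
  "lattice_ideal I \<Longrightarrow> sup x y \<in> I \<longleftrightarrow> x \<in> I \<and> y \<in> I"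
  unfolding lattice_ideal_def by (meson sup_ge1 sup_ge2)

lemma lattice_filter_inf_iff:
  "lattice_filter F \<Longrightarrow> inf x y \<in> F \<longleftrightarrow> x \<in> F \<and> y \<in> F"
  unfolding lattice_filter_def by (meson inf_le1 inf_le2)

lemma prime_ideal_inf_iff:
  "prime_ideal I \<Longrightarrow> inf x y \<in> I \<longleftrightarrow> x \<in> I \<or> y \<in> I"
  unfolding prime_ideal_def proper_ideal_def lattice_ideal_def by (meson inf_le1 inf_le2)

lemma prime_filter_sup_iff:
  "prime_filter F \<Longrightarrow> sup x y \<in> F \<longleftrightarrow> x \<in> F \<or> y \<in> F"
  unfolding prime_filter_def proper_filter_def lattice_filter_def by (meson sup_ge1 sup_ge2)

lemma bot_in_lattice_ideal: "lattice_ideal I \<Longrightarrow> bot \<in> I"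
  for I :: "'a::bounded_lattice set"
  unfolding lattice_ideal_def by (meson bot_least ex_in_conv)

lemma top_in_lattice_filter: "lattice_filter F \<Longrightarrow> top \<in> F"
  for F :: "'a::bounded_lattice set"
  unfolding lattice_filter_def by (meson top_greatest ex_in_conv)

text \<open>An ideal containing \<open>top\<close> is everything by down-closure. Unlike
  \<open>I \<noteq> UNIV\<close>, the condition on \<open>top\<close> visibly survives unions of
  chains, as Zorn's lemma requires.\<close>

lemma proper_ideal_iff_top: "proper_ideal I \<longleftrightarrow> lattice_ideal I \<and> top \<notin> I"
  for I :: "'a::bounded_lattice set"
  unfolding proper_ideal_def lattice_ideal_def by (blast intro: top_greatest)

lemma proper_filter_iff_bot: "proper_filter F \<longleftrightarrow> lattice_filter F \<and> bot \<notin> F"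
  for F :: "'a::bounded_lattice set"
  unfolding proper_filter_def lattice_filter_def by (blast intro: bot_least)

section \<open>Congruences with two classes\<close>

text \<open>The relation is the kernel of the map onto the two-element lattice that sends
  \<open>I\<close> to 0 and its complement to 1. It preserves joins because \<open>I\<close> is an
  ideal, and meets because \<open>I\<close> is prime.\<close>

lemma lattice_congruence_prime_ideal:
  assumes "prime_ideal I"
  shows "lattice_congruence {(u, v). u \<in> I \<longleftrightarrow> v \<in> I}"
proof -
  have "lattice_ideal I"
    using assms by (simp add: prime_ideal_def proper_ideal_def)
  then show ?thesis
    using assms unfolding lattice_congruence_def
    by (auto intro!: equivI refl_onI symI transI
        simp: lattice_ideal_sup_iff prime_ideal_inf_iff)
qed

lemma lattice_congruence_prime_filter:
  assumes "prime_filter F"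
  shows "lattice_congruence {(u, v). u \<in> F \<longleftrightarrow> v \<in> F}"
proof -
  have "lattice_filter F"
    using assms by (simp add: prime_filter_def proper_filter_def)
  then show ?thesis
    using assms unfolding lattice_congruence_def
    by (auto intro!: equivI refl_onI symI transI
        simp: lattice_filter_inf_iff prime_filter_sup_iff)
qed

section \<open>Existence of maximal ideals and filters\<close>

lemma lattice_ideal_Union_chain:
  assumes "C \<noteq> {}" "subset.chain {I. lattice_ideal I} C"
  shows "lattice_ideal (\<Union>C)"
  unfolding lattice_ideal_def
proof (intro conjI ballI allI impI)
  have ideal: "lattice_ideal I" if "I \<in> C" for I
    using assms that by (auto simp: subset_chain_def)
  show "\<Union>C \<noteq> {}"
    using assms(1) ideal by (auto simp: lattice_ideal_def)
  show "y \<in> \<Union>C" if "x \<in> \<Union>C" "y \<le> x" for x y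
    using that ideal unfolding lattice_ideal_def by blast
  show "sup x y \<in> \<Union>C" if xy: "x \<in> \<Union>C" "y \<in> \<Union>C" for x y
  proof -
    obtain I J where IJ: "I \<in> C" "J \<in> C" "x \<in> I" "y \<in> J" using xy by blast
    \<comment> \<open>Comparability puts \<open>x\<close> and \<open>y\<close> into a common member
      of the chain, which is closed under joins.\<close>
    with assms(2) have "I \<subseteq> J \<or> J \<subseteq> I" by (simp add: subset_chain_def)
    with IJ ideal show ?thesis unfolding lattice_ideal_def by blast
  qed
qed

lemma lattice_filter_Union_chain:
  assumes "C \<noteq> {}" "subset.chain {F. lattice_filter F} C"
  shows "lattice_filter (\<Union>C)"
  unfolding lattice_filter_def
proof (intro conjI ballI allI impI)
  have filt: "lattice_filter F" if "F \<in> C" for F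
    using assms that by (auto simp: subset_chain_def)
  show "\<Union>C \<noteq> {}"
    using assms(1) filt by (auto simp: lattice_filter_def)
  show "y \<in> \<Union>C" if "x \<in> \<Union>C" "x \<le> y" for x y
    using that filt unfolding lattice_filter_def by blast
  show "inf x y \<in> \<Union>C" if xy: "x \<in> \<Union>C" "y \<in> \<Union>C" for x y
  proof -
    obtain F G where FG: "F \<in> C" "G \<in> C" "x \<in> F" "y \<in> G" using xy by blast
    with assms(2) have "F \<subseteq> G \<or> G \<subseteq> F" by (simp add: subset_chain_def)
    with FG filt show ?thesis unfolding lattice_filter_def by blast
  qed
qed

lemma maximal_ideal_extension:
  fixes I :: "'a::bounded_lattice set"
  assumes "proper_ideal I"
  obtains M where "maximal_ideal M" "I \<subseteq> M"
proof -
  let ?A = "{J. proper_ideal J \<and> I \<subseteq> J}"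
  have "\<exists>M\<in>?A. \<forall>J\<in>?A. M \<subseteq> J \<longrightarrow> J = M"
  proof (rule subset_Zorn_nonempty)
    show "?A \<noteq> {}" using assms by blast
    fix C assume C: "C \<noteq> {}" "subset.chain ?A C"
    then have "subset.chain {J. lattice_ideal J} C"
      by (auto simp: subset_chain_def proper_ideal_def)
    then have "lattice_ideal (\<Union>C)" using C(1) by (rule lattice_ideal_Union_chain[rotated])
    \<comment> \<open>No member of \<open>C\<close> contains \<open>top\<close>; as \<open>C\<close>
      is nonempty, some member contains \<open>I\<close>.\<close>
    moreover have "top \<notin> \<Union>C" "I \<subseteq> \<Union>C"
      using C by (auto simp: subset_chain_def proper_ideal_iff_top ex_in_conv[symmetric])
    ultimately show "\<Union>C \<in> ?A" by (simp add: proper_ideal_iff_top)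
  qed
  then obtain M where "proper_ideal M" "I \<subseteq> M" and "\<forall>J\<in>?A. M \<subseteq> J \<longrightarrow> J = M" by blast
  then have "maximal_ideal M" unfolding maximal_ideal_def by blast
  with \<open>I \<subseteq> M\<close> show thesis using that by blast
qed

lemma maximal_filter_extension:
  fixes F :: "'a::bounded_lattice set"
  assumes "proper_filter F"
  obtains M where "maximal_filter M" "F \<subseteq> M"
proof -
  let ?A = "{G. proper_filter G \<and> F \<subseteq> G}"
  have "\<exists>M\<in>?A. \<forall>G\<in>?A. M \<subseteq> G \<longrightarrow> G = M"
  proof (rule subset_Zorn_nonempty)
    show "?A \<noteq> {}" using assms by blast
    fix C assume C: "C \<noteq> {}" "subset.chain ?A C"
    then have "subset.chain {G. lattice_filter G} C"
      by (auto simp: subset_chain_def proper_filter_def)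
    then have "lattice_filter (\<Union>C)" using C(1) by (rule lattice_filter_Union_chain[rotated])
    moreover have "bot \<notin> \<Union>C" "F \<subseteq> \<Union>C"
      using C by (auto simp: subset_chain_def proper_filter_iff_bot ex_in_conv[symmetric])
    ultimately show "\<Union>C \<in> ?A" by (simp add: proper_filter_iff_bot)
  qed
  then obtain M where "proper_filter M" "F \<subseteq> M" and "\<forall>G\<in>?A. M \<subseteq> G \<longrightarrow> G = M" by blast
  then have "maximal_filter M" unfolding maximal_filter_def by blast
  with \<open>F \<subseteq> M\<close> show thesis using that by blast
qed

section \<open>Complements relative to maximal ideals and filters\<close>

lemma maximal_ideal_complement:
  fixes I :: "'a::bounded_lattice set"
  assumes "maximal_ideal I" "x \<notin> I"
  obtains m where "m \<in> I" "sup x m = top"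
proof -
  have "\<exists>m\<in>I. sup x m = top"
  proof (rule ccontr)
    assume no: "\<not> (\<exists>m\<in>I. sup x m = top)"
    have I: "lattice_ideal I"
      using assms by (simp add: maximal_ideal_def proper_ideal_def)
    \<comment> \<open>The ideal generated by \<open>I\<close> and \<open>x\<close>. Were it proper,
      maximality would force it to equal \<open>I\<close>, although \<open>x\<close> lies outside
      \<open>I\<close>.\<close>
    let ?J = "{z. \<exists>m\<in>I. z \<le> sup x m}"
    have "sup u v \<in> ?J" if uv: "u \<in> ?J" "v \<in> ?J" for u v
    proof -
      obtain m n where "m \<in> I" "n \<in> I" "u \<le> sup x m" "v \<le> sup x n" using uv by blast
      moreover have "sup u v \<le> sup x (sup m n)" if "u \<le> sup x m" "v \<le> sup x n"
        using sup_mono[OF that] by (simp add: sup_aci)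
      ultimately show ?thesis using I lattice_ideal_sup_iff by blast
    qed
    \<comment> \<open>The witness for \<open>x\<close> is \<open>bot\<close>; each element of
      \<open>I\<close> is its own witness.\<close>
    moreover have "x \<in> ?J" "I \<subseteq> ?J"
      using bot_in_lattice_ideal[OF I] by (auto intro: sup_ge1 sup_ge2)
    ultimately have "lattice_ideal ?J"
      unfolding lattice_ideal_def by (auto intro: order_trans)
    moreover have "top \<notin> ?J"
      using no by (auto simp: top_unique)
    ultimately have "?J = I"
      using assms(1) \<open>I \<subseteq> ?J\<close> by (simp add: maximal_ideal_def proper_ideal_iff_top)
    with \<open>x \<in> ?J\<close> assms(2) show False by blast
  qed
  with that show thesis by blast
qed

lemma maximal_filter_complement:
  fixes F :: "'a::bounded_lattice set"
  assumes "maximal_filter F" "x \<notin> F"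
  obtains m where "m \<in> F" "inf x m = bot"
proof -
  have "\<exists>m\<in>F. inf x m = bot"
  proof (rule ccontr)
    assume no: "\<not> (\<exists>m\<in>F. inf x m = bot)"
    have F: "lattice_filter F"
      using assms by (simp add: maximal_filter_def proper_filter_def)
    \<comment> \<open>Dually, the filter generated by \<open>F\<close> and \<open>x\<close>.\<close>
    let ?G = "{z. \<exists>m\<in>F. inf x m \<le> z}"
    have "inf u v \<in> ?G" if uv: "u \<in> ?G" "v \<in> ?G" for u v
    proof -
      obtain m n where "m \<in> F" "n \<in> F" "inf x m \<le> u" "inf x n \<le> v" using uv by blast
      moreover have "inf x (inf m n) \<le> inf u v" if "inf x m \<le> u" "inf x n \<le> v"
        using inf_mono[OF that] by (simp add: inf_aci)
      ultimately show ?thesis using F lattice_filter_inf_iff by blast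
    qed
    moreover have "x \<in> ?G" "F \<subseteq> ?G"
      using top_in_lattice_filter[OF F] by (auto intro: inf_le1 inf_le2)
    ultimately have "lattice_filter ?G"
      unfolding lattice_filter_def by (auto intro: order_trans)
    moreover have "bot \<notin> ?G"
      using no by (auto simp: bot_unique)
    ultimately have "?G = F"
      using assms(1) \<open>F \<subseteq> ?G\<close> by (simp add: maximal_filter_def proper_filter_iff_bot)
    with \<open>x \<in> ?G\<close> assms(2) show False by blast
  qed
  with that show thesis by blast
qed

section \<open>From d-lattices to primeness\<close>

lemma theta_sup: "(sup x a, sup x b) \<in> theta a b"
  using lattice_congruence_theta[of a b] theta_contains[of a b]
  by (auto simp: lattice_congruence_def equiv_def refl_on_def)

lemma theta_inf: "(inf x a, inf x b) \<in> theta a b"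
  using lattice_congruence_theta[of a b] theta_contains[of a b]
  by (auto simp: lattice_congruence_def equiv_def refl_on_def)

lemma d_lattice_maximal_ideal_prime:
  fixes I :: "'a::bounded_lattice set"
  assumes d: "d_lattice TYPE('a)" and I: "maximal_ideal I"
  shows "prime_ideal I"
proof -
  have proper: "proper_ideal I" and ideal: "lattice_ideal I"
    using I by (simp_all add: maximal_ideal_def proper_ideal_def)
  have "x \<in> I \<or> y \<in> I" if xy: "inf x y \<in> I" for x y
  proof (rule ccontr)
    assume "\<not> (x \<in> I \<or> y \<in> I)"
    then obtain p q where pq: "p \<in> I" "q \<in> I" "sup x p = top" "sup y q = top"
      using maximal_ideal_complement[OF I] by metis
    \<comment> \<open>Joining \<open>p\<close> and \<open>q\<close> lets one element serve both
      \<open>x\<close> and \<open>y\<close>; joining \<open>inf x y\<close> as well makes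
      \<open>sup (inf x y) m\<close> collapse to \<open>m\<close>, so that the final equation puts
      \<open>top\<close> into \<open>I\<close>.\<close>
    define m where "m = sup (inf x y) (sup p q)"
    have m: "m \<in> I" "inf x y \<le> m"
      using xy pq ideal by (simp_all add: m_def lattice_ideal_sup_iff)
    have "sup x p \<le> sup x m" "sup y q \<le> sup y m"
      by (auto simp: m_def intro: le_supI1 le_supI2)
    then have "sup x m = top" "sup y m = top"
      using pq by (simp_all add: top_unique)
    \<comment> \<open>Since \<open>sup x bot = x\<close>, joining the generating pair with
      \<open>x\<close> relates \<open>x\<close> to \<open>sup x m\<close>, which is
      \<open>top\<close>; likewise for \<open>y\<close>.\<close>
    then have "(x, top) \<in> theta bot m" "(y, top) \<in> theta bot m"
      using theta_sup[of x bot m] theta_sup[of y bot m] by simp_all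
    then have "(inf x y, inf top top) \<in> theta bot m"
      using lattice_congruence_theta[of bot m] unfolding lattice_congruence_def by blast
    then have "sup (inf x y) m = top"
      using d by (simp add: d_lattice_def)
    then show False
      using m proper by (simp add: sup_absorb2 proper_ideal_iff_top)
  qed
  with proper show ?thesis by (simp add: prime_ideal_def)
qed

lemma d_lattice_maximal_filter_prime:
  fixes F :: "'a::bounded_lattice set"
  assumes d: "d_lattice TYPE('a)" and F: "maximal_filter F"
  shows "prime_filter F"
proof -
  have proper: "proper_filter F" and filt: "lattice_filter F"
    using F by (simp_all add: maximal_filter_def proper_filter_def)
  have "x \<in> F \<or> y \<in> F" if xy: "sup x y \<in> F" for x y
  proof (rule ccontr)
    assume "\<not> (x \<in> F \<or> y \<in> F)"
    then obtain p q where pq: "p \<in> F" "q \<in> F" "inf x p = bot" "inf y q = bot"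
      using maximal_filter_complement[OF F] by metis
    \<comment> \<open>The meet with \<open>sup x y\<close> makes \<open>inf (sup x y) m\<close>
      equal to \<open>m\<close>, so that the final equation puts \<open>bot\<close> into
      \<open>F\<close>.\<close>
    define m where "m = inf (sup x y) (inf p q)"
    have m: "m \<in> F" "m \<le> sup x y"
      using xy pq filt by (simp_all add: m_def lattice_filter_inf_iff)
    have "inf x m \<le> inf x p" "inf y m \<le> inf y q"
      by (auto simp: m_def intro: le_infI1 le_infI2)
    then have "inf x m = bot" "inf y m = bot"
      using pq by (simp_all add: bot_unique)
    then have "(x, bot) \<in> theta top m" "(y, bot) \<in> theta top m"
      using theta_inf[of x top m] theta_inf[of y top m] by simp_all
    then have "(sup x y, sup bot bot) \<in> theta top m"
      using lattice_congruence_theta[of top m] unfolding lattice_congruence_def by blast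
    then have "inf (sup x y) m = bot"
      using d by (simp add: d_lattice_def)
    then show False
      using m proper by (simp add: inf_absorb2 proper_filter_iff_bot)
  qed
  with proper show ?thesis by (simp add: prime_filter_def)
qed

section \<open>From primeness to d-lattices\<close>

lemma sup_eq_top_if_theta_bot:
  fixes a c :: "'a::bounded_lattice"
  assumes prime: "\<And>I :: 'a set. maximal_ideal I \<Longrightarrow> prime_ideal I"
    and ac: "(a, top) \<in> theta bot c"
  shows "sup a c = top"
proof (rule ccontr)
  assume "sup a c \<noteq> top"
  \<comment> \<open>A principal ideal is proper exactly when its generator differs from
    \<open>top\<close>.\<close>
  then have "proper_ideal {..sup a c}"
    by (auto simp: proper_ideal_iff_top lattice_ideal_def top_unique intro: order_trans)
  then obtain M where M: "maximal_ideal M" "{..sup a c} \<subseteq> M"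
    by (rule maximal_ideal_extension)
  then have "a \<in> M" "c \<in> M" "bot \<in> M" by auto
  \<comment> \<open>Both \<open>bot\<close> and \<open>c\<close> lie in \<open>M\<close>, so the
    two-class congruence of \<open>M\<close> contains the pair generating
    \<open>theta bot c\<close>.\<close>
  then have "theta bot c \<subseteq> {(u, v). u \<in> M \<longleftrightarrow> v \<in> M}"
    using prime[OF M(1)] by (intro theta_least lattice_congruence_prime_ideal) auto
  with ac \<open>a \<in> M\<close> have "top \<in> M" by blast
  with M(1) show False by (simp add: maximal_ideal_def proper_ideal_iff_top)
qed

lemma inf_eq_bot_if_theta_top:
  fixes a c :: "'a::bounded_lattice"
  assumes prime: "\<And>F :: 'a set. maximal_filter F \<Longrightarrow> prime_filter F"
    and ac: "(a, bot) \<in> theta top c"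
  shows "inf a c = bot"
proof (rule ccontr)
  assume "inf a c \<noteq> bot"
  then have "proper_filter {inf a c..}"
    by (auto simp: proper_filter_iff_bot lattice_filter_def bot_unique intro: order_trans)
  then obtain M where M: "maximal_filter M" "{inf a c..} \<subseteq> M"
    by (rule maximal_filter_extension)
  then have "a \<in> M" "c \<in> M" "top \<in> M" by auto
  \<comment> \<open>Here the generating pair \<open>(top, c)\<close> lies inside the class
    \<open>M\<close>.\<close>
  then have "theta top c \<subseteq> {(u, v). u \<in> M \<longleftrightarrow> v \<in> M}"
    using prime[OF M(1)] by (intro theta_least lattice_congruence_prime_filter) auto
  with ac \<open>a \<in> M\<close> have "bot \<in> M" by blast
  with M(1) show False by (simp add: maximal_filter_def proper_filter_iff_bot)
qed

theorem theorem1: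
  shows "d_lattice TYPE('a::bounded_lattice) \<longleftrightarrow>
    (\<forall>I :: 'a set. maximal_ideal I \<longrightarrow> prime_ideal I) \<and>
    (\<forall>F :: 'a set. maximal_filter F \<longrightarrow> prime_filter F)"
proof (intro iffI conjI)
  assume "(\<forall>I :: 'a set. maximal_ideal I \<longrightarrow> prime_ideal I) \<and>
    (\<forall>F :: 'a set. maximal_filter F \<longrightarrow> prime_filter F)"
  then show "d_lattice TYPE('a)"
    unfolding d_lattice_def
    by (blast intro: sup_eq_top_if_theta_bot inf_eq_bot_if_theta_top)
qed (auto intro: d_lattice_maximal_ideal_prime d_lattice_maximal_filter_prime)

end
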